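(* The maps $F_C:\mathbb{R}^3_{\ge0}\to\mathbb{R}^3_{\ge0}$ and $F_S:\Gamma\to\Gamma$ are conjugate, i.e., there exists a linear homeomorphism $z:\mathbb{R}^3_{\ge0}\to\Gamma$ such that $z\circ F_C=F_S\circ z$. Furthermore, for all $\mathbf{x}\in\mathbb{R}^3$, we have $\dim_{\mathbb{Q}}(\mathbf{x})=\dim_{\mathbb{Q}}(z(\mathbf{x}))$.
   Context: $F_C(x_1,x_2,x_3)=(x_1-x_3,x_3,x_2)$ if $x_1\ge x_3$ and $F_C(x_1,x_2,x_3)=(x_2,x_1,x_3-x_1)$ if $x_1<x_3$. Let $\Theta=\{(x_1,x_2,x_3)\in\mathbb{R}^3_{\ge0}\mid\max(x_2,x_3)\le x_1\}$, $\Theta_1=\{\mathbf{x}\in\Theta\mid x_1\le x_2+x_3,\ x_2\ge x_3\}$, $\Theta_2=\{\mathbf{x}\in\Theta\mid x_1\le x_2+x_3,\ x_2<x_3\}$, and $\Gamma=\Theta_1\cup\Theta_2$. The semi-sorted Selmer algorithm restricted to $\Gamma$ is $F_S(x_1,x_2,x_3)=(x_2,x_1-x_3,x_3)$ on $\Theta_1$ and $F_S(x_1,x_2,x_3)=(x_3,x_2,x_1-x_2)$ on $\Theta_2$. "Linear homeomorphism" means a homeomorphism that is the restriction of a linear map $\mathbb{R}^3\to\mathbb{R}^3$; this linear map is also denoted $z$. $\dim_{\mathbb{Q}}(\mathbf{x})$ is the dimension of the $\mathbb{Q}$-vector space spanned by the entries of $\mathbf{x}$. *)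

theory Defs
  imports "HOL-Analysis.Analysis"
begin

definition nonneg_octant :: "(real^3) set" where
  "nonneg_octant = {x. \<forall>i. 0 \<le> x $ i}"

text \<open>Used only on \<^const>\<open>nonneg_octant\<close>.\<close>

definition F\<^sub>C :: "real^3 \<Rightarrow> real^3" where
  "F\<^sub>C x = (if x $ 1 \<ge> x $ 3
           then vector [x $ 1 - x $ 3, x $ 3, x $ 2]
           else vector [x $ 2, x $ 1, x $ 3 - x $ 1])"

definition \<Theta> :: "(real^3) set" where
  "\<Theta> = {x \<in> nonneg_octant. max (x $ 2) (x $ 3) \<le> x $ 1}"

definition \<Theta>\<^sub>1 :: "(real^3) set" where
  "\<Theta>\<^sub>1 = {x \<in> \<Theta>. x $ 1 \<le> x $ 2 + x $ 3 \<and> x $ 2 \<ge> x $ 3}"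

definition \<Theta>\<^sub>2 :: "(real^3) set" where
  "\<Theta>\<^sub>2 = {x \<in> \<Theta>. x $ 1 \<le> x $ 2 + x $ 3 \<and> x $ 2 < x $ 3}"

definition \<Gamma> :: "(real^3) set" where
  "\<Gamma> = \<Theta>\<^sub>1 \<union> \<Theta>\<^sub>2"

text \<open>Used only on \<^const>\<open>\<Gamma>\<close>, where the second branch is the case \<^term>\<open>x \<in> \<Theta>\<^sub>2\<close>;
  the values outside \<^const>\<open>\<Gamma>\<close> are irrelevant.\<close>

definition F\<^sub>S :: "real^3 \<Rightarrow> real^3" where
  "F\<^sub>S x = (if x \<in> \<Theta>\<^sub>1
           then vector [x $ 2, x $ 1 - x $ 3, x $ 3]
           else vector [x $ 3, x $ 2, x $ 1 - x $ 2])"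

global_interpretation real_over_rat: vector_space "\<lambda>(q::rat) (r::real). of_rat q * r"
  by unfold_locales (simp_all add: algebra_simps of_rat_add of_rat_mult)

definition dim_rat :: "real^3 \<Rightarrow> nat" where
  "dim_rat x = real_over_rat.dim (real_over_rat.span (range (\<lambda>i. x $ i)))"

end

theory Submission
  imports Defs
begin

text \<open>The cone \<open>\<Gamma>\<close> is cut out by the three inequalities \<open>y\<^sub>1 - y\<^sub>3 \<ge> 0\<close>, \<open>y\<^sub>2 + y\<^sub>3 - y\<^sub>1 \<ge> 0\<close>
  and \<open>y\<^sub>1 - y\<^sub>2 \<ge> 0\<close>, so taking these three forms as coordinates identifies it linearly with the
  octant. In this order of the coordinates, \<open>x\<^sub>1 \<ge> x\<^sub>3\<close> becomes \<open>y\<^sub>2 \<ge> y\<^sub>3\<close>, and the branches of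
  the two maps correspond. The coordinate change is unimodular, hence preserves rational spans.\<close>

text \<open>The images of the unit vectors, (1,1,0), (1,1,1) and (1,0,1), span the extreme rays of
  \<open>\<Gamma>\<close>.\<close>

definition octant_to_\<Gamma> :: "real^3 \<Rightarrow> real^3" where
  "octant_to_\<Gamma> x = vector [x $ 1 + x $ 2 + x $ 3, x $ 1 + x $ 2, x $ 2 + x $ 3]"

definition \<Gamma>_to_octant :: "real^3 \<Rightarrow> real^3" where
  "\<Gamma>_to_octant y = vector [y $ 1 - y $ 3, y $ 2 + y $ 3 - y $ 1, y $ 1 - y $ 2]"

lemma mem_nonneg_octant_iff:
  "x \<in> nonneg_octant \<longleftrightarrow> 0 \<le> x $ 1 \<and> 0 \<le> x $ 2 \<and> 0 \<le> x $ 3"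
  by (simp add: nonneg_octant_def forall_3)

text \<open>Nonnegativity follows from the three inequalities: y2 >= y1 - y3 >= 0, symmetrically y3
  >= 0, and then y1 >= y2 >= 0.\<close>

lemma mem_\<Gamma>_iff:
  "y \<in> \<Gamma> \<longleftrightarrow> y $ 2 \<le> y $ 1 \<and> y $ 3 \<le> y $ 1 \<and> y $ 1 \<le> y $ 2 + y $ 3"
  by (auto simp: \<Gamma>_def \<Theta>\<^sub>1_def \<Theta>\<^sub>2_def \<Theta>_def mem_nonneg_octant_iff)

lemma mem_\<Theta>\<^sub>1_iff: "y \<in> \<Theta>\<^sub>1 \<longleftrightarrow> y \<in> \<Gamma> \<and> y $ 3 \<le> y $ 2"
  by (auto simp: \<Gamma>_def \<Theta>\<^sub>1_def \<Theta>\<^sub>2_def)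

lemma linear_octant_to_\<Gamma>: "linear octant_to_\<Gamma>"
  by (rule linearI) (simp_all add: octant_to_\<Gamma>_def vec_eq_iff forall_3 algebra_simps)

lemma linear_\<Gamma>_to_octant: "linear \<Gamma>_to_octant"
  by (rule linearI) (simp_all add: \<Gamma>_to_octant_def vec_eq_iff forall_3 algebra_simps)

lemma \<Gamma>_to_octant_to_\<Gamma> [simp]: "\<Gamma>_to_octant (octant_to_\<Gamma> x) = x"
  by (simp add: octant_to_\<Gamma>_def \<Gamma>_to_octant_def vec_eq_iff forall_3)

lemma octant_to_\<Gamma>_to_octant [simp]: "octant_to_\<Gamma> (\<Gamma>_to_octant y) = y"
  by (simp add: octant_to_\<Gamma>_def \<Gamma>_to_octant_def vec_eq_iff forall_3)

text \<open>As an equivalence on all of R^3, this gives both inclusions of the image equality once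
  every point is known to have a preimage.\<close>

lemma octant_to_\<Gamma>_mem_iff: "octant_to_\<Gamma> x \<in> \<Gamma> \<longleftrightarrow> x \<in> nonneg_octant"
  by (auto simp: octant_to_\<Gamma>_def mem_\<Gamma>_iff mem_nonneg_octant_iff)

lemma image_octant_to_\<Gamma>: "octant_to_\<Gamma> ` nonneg_octant = \<Gamma>"
  by (metis (no_types, lifting) octant_to_\<Gamma>_mem_iff octant_to_\<Gamma>_to_octant imageE imageI
      subsetI subset_antisym)

lemma homeomorphism_octant_\<Gamma>: "homeomorphism nonneg_octant \<Gamma> octant_to_\<Gamma> \<Gamma>_to_octant"
proof (rule homeomorphismI)
  show "\<Gamma>_to_octant ` \<Gamma> \<subseteq> nonneg_octant"
    by (metis image_subsetI octant_to_\<Gamma>_mem_iff octant_to_\<Gamma>_to_octant)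
qed (simp_all add: image_octant_to_\<Gamma> linear_continuous_on linear_linear
    linear_octant_to_\<Gamma> linear_\<Gamma>_to_octant)

lemma F\<^sub>C_mem_nonneg_octant: "x \<in> nonneg_octant \<Longrightarrow> F\<^sub>C x \<in> nonneg_octant"
  by (auto simp: F\<^sub>C_def mem_nonneg_octant_iff)

lemma octant_to_\<Gamma>_F\<^sub>C:
  assumes "x \<in> nonneg_octant"
  shows "octant_to_\<Gamma> (F\<^sub>C x) = F\<^sub>S (octant_to_\<Gamma> x)"
proof -
  \<comment> \<open>The second entry of the image minus the third is x1 - x3. Membership in
    \<open>\<Gamma>\<close> is settled first, while \<open>octant_to_\<Gamma>\<close> is still
    folded.\<close>
  have "octant_to_\<Gamma> x \<in> \<Theta>\<^sub>1 \<longleftrightarrow> x $ 3 \<le> x $ 1"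
    using assms by (simp add: mem_\<Theta>\<^sub>1_iff octant_to_\<Gamma>_mem_iff) (simp add: octant_to_\<Gamma>_def)
  then show ?thesis
    by (simp add: F\<^sub>C_def F\<^sub>S_def) (simp add: octant_to_\<Gamma>_def vec_eq_iff forall_3)
qed

text \<open>Invariance is carried over from the octant by the conjugacy.\<close>

lemma F\<^sub>S_mem_\<Gamma>:
  assumes "y \<in> \<Gamma>"
  shows "F\<^sub>S y \<in> \<Gamma>"
proof -
  obtain x where "x \<in> nonneg_octant" "y = octant_to_\<Gamma> x"
    using assms image_octant_to_\<Gamma> by blast
  then show ?thesis
    by (simp add: octant_to_\<Gamma>_mem_iff F\<^sub>C_mem_nonneg_octant flip: octant_to_\<Gamma>_F\<^sub>C)
qed

text \<open>Both coordinate changes only add and subtract entries, so each vector has its entries in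
  the rational span of the other's, and the two spans coincide.\<close>

lemma dim_rat_octant_to_\<Gamma>: "dim_rat (octant_to_\<Gamma> x) = dim_rat x"
proof -
  let ?S = "\<lambda>v :: real^3. real_over_rat.span (range (\<lambda>i. v $ i))"
  have entry: "v $ i \<in> ?S v" for v :: "real^3" and i
    by (simp add: real_over_rat.span_base)
  have "octant_to_\<Gamma> v $ i \<in> ?S v" for v i
    using exhaust_3[of i]
    by (auto simp: octant_to_\<Gamma>_def intro!: real_over_rat.span_add entry)
  moreover have "\<Gamma>_to_octant v $ i \<in> ?S v" for v i
    using exhaust_3[of i]
    by (auto simp: \<Gamma>_to_octant_def
        intro!: real_over_rat.span_add real_over_rat.span_diff entry)
  \<comment> \<open>At an image point the inverse cancels, which recovers the entries of x.\<close>
  from this[of "octant_to_\<Gamma> x"] have "x $ i \<in> ?S (octant_to_\<Gamma> x)" for i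
    by simp
  ultimately have "?S (octant_to_\<Gamma> x) = ?S x"
    by (auto simp: real_over_rat.span_eq)
  then show ?thesis
    by (simp add: dim_rat_def)
qed

theorem proposition11p1:
  shows "F\<^sub>C ` nonneg_octant \<subseteq> nonneg_octant \<and> F\<^sub>S ` \<Gamma> \<subseteq> \<Gamma> \<and>
    (\<exists>z :: real^3 \<Rightarrow> real^3.
       linear z \<and>
       (\<exists>z'. homeomorphism nonneg_octant \<Gamma> z z') \<and>
       (\<forall>x \<in> nonneg_octant. z (F\<^sub>C x) = F\<^sub>S (z x)) \<and>
       (\<forall>x. dim_rat x = dim_rat (z x)))"
proof (intro conjI)
  have "\<exists>z'. homeomorphism nonneg_octant \<Gamma> octant_to_\<Gamma> z'"
    using homeomorphism_octant_\<Gamma> by blast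
  then show "\<exists>z :: real^3 \<Rightarrow> real^3.
       linear z \<and>
       (\<exists>z'. homeomorphism nonneg_octant \<Gamma> z z') \<and>
       (\<forall>x \<in> nonneg_octant. z (F\<^sub>C x) = F\<^sub>S (z x)) \<and>
       (\<forall>x. dim_rat x = dim_rat (z x))"
    by (intro exI[of "\<lambda>z. linear z \<and> _ z" octant_to_\<Gamma>])
      (simp add: linear_octant_to_\<Gamma> octant_to_\<Gamma>_F\<^sub>C dim_rat_octant_to_\<Gamma>)
qed (auto simp: F\<^sub>C_mem_nonneg_octant F\<^sub>S_mem_\<Gamma>)

end
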